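(* Let $s\ge2$ and $d\ge1$ be integers and let $f$ be an arbitrary (not necessarily homogeneous) polynomial of degree $s$ in $d$ variables with rational coefficients such that the set $\{\pmb{x}\in\mathbb{Q}^d: f(\pmb{x})=1\}$ is finite. Let $\pmb{\xi}=(\xi_1,\dots,\xi_d)\in\mathbb{R}^d\setminus\mathbb{Q}^d$ satisfy $f(\pmb{\xi})=1$. Then: (i) $\omega(\pmb{\xi})\le s-1$; (ii) if $\pmb{\xi}$ is totally irrational (i.e. $1,\xi_1,\dots,\xi_d$ are linearly independent over $\mathbb{Z}$), then $\hat{\omega}(\pmb{\xi})\le H_{d-1,s}$.
   Context: For $\Theta=(\theta_1,\dots,\theta_m)\in\mathbb{R}^m$, the ordinary Diophantine exponent $\omega(\Theta)$ is the supremum of all real $\gamma$ such that $\max_{1\le j\le m}|q\theta_j-a_j|<q^{-\gamma}$ has infinitely many solutions $(q,a_1,\dots,a_m)\in\mathbb{Z}^{m+1}$ with $q>0$. The uniform exponent $\hat{\omega}(\Theta)$ is the supremum of all real $\gamma$ such that for every sufficiently large real $Q$ the system $\max_{1\le j\le m}|q\theta_j-a_j|<Q^{-\gamma}$, $1\le q\le Q$, has a solution $(q,a_1,\dots,a_m)\in\mathbb{Z}^{m+1}$. For integers $s\ge2$ and $n\ge0$, $H_{n,s}$ denotes the unique positive root of $1-x=x\sum_{k=1}^{n}\left(\frac{x}{s-1}\right)^k$ (for $n=0$ the sum is empty, so $H_{0,s}=1$). *)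

theory Defs
  imports "HOL-Analysis.Analysis" "HOL-Library.Poly_Mapping"
begin

text \<open>
  Polynomials with coefficients in \<open>'a\<close> in finitely many variables indexed by \<open>'n\<close>,
  so \<open>d = CARD('n)\<close>: a finitely supported map from exponent vectors to coefficients.
\<close>

type_synonym ('n, 'a) mpoly = "('n \<Rightarrow>\<^sub>0 nat) \<Rightarrow>\<^sub>0 'a"

text \<open>Total degree; the zero polynomial gets degree 0.\<close>

definition total_degree :: "('n::finite, 'a::zero) mpoly \<Rightarrow> nat" where
  "total_degree f = Max (insert 0 ((\<lambda>m. \<Sum>i\<in>UNIV. Poly_Mapping.lookup m i) ` Poly_Mapping.keys f))"

definition mpoly_eval :: "('n::finite, rat) mpoly \<Rightarrow> 'b::field_char_0 ^ 'n \<Rightarrow> 'b" where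
  "mpoly_eval f x = (\<Sum>m\<in>Poly_Mapping.keys f. of_rat (Poly_Mapping.lookup f m) * (\<Prod>i\<in>UNIV. (x $ i) ^ Poly_Mapping.lookup m i))"

text \<open>The exponents take values in \<^typ>\<open>ereal\<close> because the suprema may be infinite.\<close>

definition omega :: "real ^ 'm::finite \<Rightarrow> ereal" where
  "omega \<theta> = Sup {ereal \<gamma> | \<gamma>.
     infinite {(q :: int, a :: int ^ 'm). 0 < q \<and>
       Max (range (\<lambda>j. \<bar>of_int q * \<theta> $ j - of_int (a $ j)\<bar>)) < of_int q powr (- \<gamma>)}}"

definition omega_hat :: "real ^ 'm::finite \<Rightarrow> ereal" where
  "omega_hat \<theta> = Sup {ereal \<gamma> | \<gamma>.
     \<forall>\<^sub>F Q :: real in at_top. \<exists>(q :: int) (a :: int ^ 'm). 1 \<le> q \<and> of_int q \<le> Q \<and>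
       Max (range (\<lambda>j. \<bar>of_int q * \<theta> $ j - of_int (a $ j)\<bar>)) < Q powr (- \<gamma>)}"

definition totally_irrational :: "real ^ 'm::finite \<Rightarrow> bool" where
  "totally_irrational \<theta> \<longleftrightarrow> (\<forall>(b :: int) (c :: int ^ 'm).
     of_int b + (\<Sum>j\<in>UNIV. of_int (c $ j) * \<theta> $ j) = 0 \<longrightarrow> b = 0 \<and> c = 0)"

definition H :: "nat \<Rightarrow> nat \<Rightarrow> real" where
  "H n s = (THE x. 0 < x \<and> 1 - x = x * (\<Sum>k=1..n. (x / (real s - 1)) ^ k))"

lemma H_ex1:
  assumes "2 \<le> s"
  shows "\<exists>!x::real. 0 < x \<and> 1 - x = x * (\<Sum>k=1..n. (x / (real s - 1)) ^ k)"
proof -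
  define g where "g x = x + x * (\<Sum>k=1..n. (x / (real s - 1)) ^ k)" for x :: real
  have s1: "real s - 1 > 0" using assms by simp
  have g_iff: "1 - x = x * (\<Sum>k=1..n. (x / (real s - 1)) ^ k) \<longleftrightarrow> g x = 1" for x
    by (auto simp: g_def)
  have mono: "g x < g y" if "0 < x" "x < y" for x y
  proof -
    have "(\<Sum>k=1..n. (x / (real s - 1)) ^ k) \<le> (\<Sum>k=1..n. (y / (real s - 1)) ^ k)"
      using that s1 by (intro sum_mono power_mono divide_right_mono) auto
    moreover have "0 \<le> (\<Sum>k=1..n. (x / (real s - 1)) ^ k)"
      using that s1 by (intro sum_nonneg) auto
    ultimately have "x * (\<Sum>k=1..n. (x / (real s - 1)) ^ k) \<le> y * (\<Sum>k=1..n. (y / (real s - 1)) ^ k)"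
      using that by (intro mult_mono) auto
    then show ?thesis using that by (simp add: g_def)
  qed
  have "continuous_on {0..1} g"
    unfolding g_def using s1 by (intro continuous_intros) auto
  moreover have "g 0 \<le> 1" by (simp add: g_def)
  moreover have "1 \<le> g 1"
    using s1 by (simp add: g_def sum_nonneg)
  ultimately obtain x where x: "0 \<le> x" "g x = 1"
    using IVT'[of g 0 1 1] by auto
  then have "0 < x" by (cases "x = 0") (auto simp: g_def)
  with x mono show ?thesis
    unfolding g_iff by (metis linorder_neqE_linordered_idom order_less_irrefl)
qed

end

(* Clearing denominators in f(p) \<noteq> 1 at a rational point p = a/q close to \<xi> gives the lower bound
   max |q \<xi>_j - a_j| \<ge> c q^(-(s-1)) for all q and a, hence (i).
   For (ii), suppose the uniform exponent exceeds h = H_{d-1,s} and let q_j be the denominators of the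
   best approximations, with errors E_j. Then E_{j-1} \<le> q_j^(-h-\<epsilon>), and together with the lower bound
   this gives q_j^g \<le> C q_{j-1} for every large j, where g = h/(s-1). Among the vectors (q_j, a_j),
   j \<ge> k, select those outside the span of their predecessors; total irrationality gives d + 1 of them.
   Subtracting from each selected vector other than the first the multiple of its immediate
   predecessor with the same first coordinate leaves their determinant, a nonzero integer, unchanged and yields
   1 \<le> (d+1)! q_k \<Prod> (2 q_j E_{j-1} / q_{j-1}). The exponents P_r = 1 - h (1 + g + ... + g^(r-1)) satisfy
   P_{r+1} = 1 - h + g (P_r - 1), so the product over the first r selected indices is at most a constant
   times the power P_r of the last q_j; since P_d = 0, the factor q_k^(-\<epsilon>) gives a contradiction. *)

theory Submission
  imports Defs
begin

section \<open>Linear algebra\<close>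


text \<open>Rows are replaced one at a time, highest rank \<open>e\<close> first. When a row is
  replaced, all rows of lower rank still hold their \<open>z\<close>, so the change lies in the span
  of other rows of the current matrix. The injection \<open>e\<close> supplies the order that the
  index type lacks.\<close>

lemma det_add_span_preceding_rows:
  fixes z w :: "'m::finite \<Rightarrow> 'a::field ^ 'm" and e :: "'m \<Rightarrow> nat"
  assumes e: "inj e" and w: "\<And>i. w i - z i \<in> vec.span (z ` {j. e j < e i})"
  shows "det (\<chi> i. w i) = det (\<chi> i. z i)"
proof -
  \<comment> \<open>Rows of rank at least \<open>t\<close> are already replaced; \<open>t\<close>
    descends from beyond \<open>Max (range e)\<close> to 0.\<close>
  define A :: "nat \<Rightarrow> 'a ^ 'm ^ 'm" where "A t = (\<chi> i. if t \<le> e i then w i else z i)" for t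
  have step: "det (A t) = det (A (Suc t))" for t
  proof (cases "t \<in> range e")
    case False
    then have ne: "e i \<noteq> t" for i by auto
    have "t \<le> e i \<longleftrightarrow> Suc t \<le> e i" for i
      using ne[of i] by presburger
    then show ?thesis unfolding A_def by presburger
  next
    case True
    then obtain i where i: "e i = t" by auto
    have row: "row k (A u) = (if u \<le> e k then w k else z k)" for k u
      by (simp add: A_def row_def vec_eq_iff)
    have "z ` {j. e j < e i} \<subseteq> {row j (A (Suc t)) |j. j \<noteq> i}"
    proof
      fix y assume "y \<in> z ` {j. e j < e i}"
      then obtain j where "e j < t" "y = z j" using i by auto
      then have "y = row j (A (Suc t)) \<and> j \<noteq> i" using i by (auto simp: row)
      then show "y \<in> {row j (A (Suc t)) |j. j \<noteq> i}" by blast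
    qed
    from vec.span_mono[OF this] have "w i - z i \<in> vec.span {row j (A (Suc t)) |j. j \<noteq> i}"
      using w[of i] by (rule subsetD)
    from det_row_span[OF this]
    have "det (\<chi> k. if k = i then row i (A (Suc t)) + (w i - z i) else row k (A (Suc t))) = det (A (Suc t))" .
    moreover have "(if k = i then row i (A (Suc t)) + (w i - z i) else row k (A (Suc t)))
        = (if t \<le> e k then w k else z k)" for k
    proof (cases "k = i")
      case True
      then show ?thesis using i by (simp add: row)
    next
      case False
      then have "e k \<noteq> t" using i e by (auto dest: injD)
      with False show ?thesis by (auto simp: row)
    qed
    ultimately show ?thesis by (simp add: A_def)
  qed
  have "det (A 0) = det (A t)" for t
    by (induction t) (simp_all add: step[symmetric])
  moreover have "A 0 = (\<chi> i. w i)"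
    by (simp add: A_def)
  moreover have "A (Suc (Max (range e))) = (\<chi> i. z i)"
  proof -
    have "e i \<le> Max (range e)" for i by simp
    then have "\<not> Suc (Max (range e)) \<le> e i" for i
      by (metis not_less_eq_eq)
    then show ?thesis by (simp add: A_def)
  qed
  ultimately show ?thesis by metis
qed

text \<open>\<open>b\<close> enumerates the indices \<open>j\<close> at which \<open>x j\<close> leaves the span of \<open>x k, \<dots>, x (j - 1)\<close>.\<close>

lemma greedy_basis:
  fixes x :: "nat \<Rightarrow> 'a::field ^ 'm::finite"
  assumes full: "\<And>v. (\<And>j. k \<le> j \<Longrightarrow> (\<Sum>i\<in>UNIV. x j $ i * v $ i) = 0) \<Longrightarrow> v = 0"
    and nz: "x k \<noteq> 0"
  obtains b :: "'m \<Rightarrow> nat" where "inj b" "k \<in> range b" "\<And>i. k \<le> b i"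
    "\<And>j. k \<le> j \<Longrightarrow> x j \<in> vec.span ((\<lambda>i. x (b i)) ` {i. b i \<le> j})"
    "det (\<chi> i. x (b i)) \<noteq> 0"
proof -
  define J where "J = {j. k \<le> j \<and> x j \<notin> vec.span (x ` {k..<j})}"
  \<comment> \<open>Injectivity is carried along so that counting indices is the same as counting
    independent vectors; this bounds \<open>card J\<close> by the dimension.\<close>
  have ind: "vec.independent (x ` (J \<inter> {..<n})) \<and> inj_on x (J \<inter> {..<n})" for n
  proof (induction n)
    case 0
    then show ?case by (simp add: vec.independent_empty)
  next
    case (Suc n)
    show ?case
    proof (cases "n \<in> J")
      case False
      then have "J \<inter> {..<Suc n} = J \<inter> {..<n}" by (auto simp: less_Suc_eq)
      with Suc show ?thesis by simp
    next
      case True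
      have eq: "J \<inter> {..<Suc n} = insert n (J \<inter> {..<n})" using True by (auto simp: less_Suc_eq)
      have "x ` (J \<inter> {..<n}) \<subseteq> x ` {k..<n}" by (auto simp: J_def)
      from vec.span_mono[OF this] True have "x n \<notin> vec.span (x ` (J \<inter> {..<n}))"
        by (auto simp: J_def)
      moreover from this have "x n \<notin> x ` (J \<inter> {..<n})"
        using vec.span_base by metis
      ultimately show ?thesis using Suc eq
        by (simp add: vec.independent_insert)
    qed
  qed
  have bound: "card (J \<inter> {..<n}) \<le> CARD('m)" for n
  proof -
    have "card (J \<inter> {..<n}) = card (x ` (J \<inter> {..<n}))"
      using ind[of n] by (simp add: card_image)
    also have "\<dots> \<le> vec.dim (x ` (J \<inter> {..<n}))"
      using ind[of n] vec.independent_bound_general by blast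
    also have "\<dots> \<le> CARD('m)"
      using vec.dim_subset_UNIV[of "x ` (J \<inter> {..<n})"] by (simp add: vec.dimension_def card_cart_basis)
    finally show ?thesis .
  qed
  have finJ: "finite J"
  proof (rule ccontr)
    assume "infinite J"
    then obtain T where T: "finite T" "card T = Suc (CARD('m))" "T \<subseteq> J"
      by (metis infinite_arbitrarily_large)
    then have "T \<subseteq> J \<inter> {..<Suc (Max T)}"
      using Max_ge[OF T(1)] by (auto simp: less_Suc_eq_le)
    then have "card T \<le> card (J \<inter> {..<Suc (Max T)})"
      by (intro card_mono) auto
    with bound[of "Suc (Max T)"] T(2) show False by simp
  qed
  then have cardJ: "card J \<le> CARD('m)"
  proof -
    have "J = J \<inter> {..<Suc (Max J)}"
      using Max_ge[OF finJ] by (auto simp: less_Suc_eq_le)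
    then show ?thesis using bound by metis
  qed
  have kJ: "k \<in> J" using nz by (simp add: J_def)
  \<comment> \<open>So far \<open>card J\<close> is only known to be at most the dimension, so
    \<open>b\<close> is merely onto \<open>J\<close>, with spare indices sent to the default
    \<open>k\<close>. Injectivity follows at the end: a repeated index would give equal rows and a
    zero determinant.\<close>
  obtain b :: "'m \<Rightarrow> nat" where b: "range b = J"
  proof -
    obtain h where h: "inj_on h J" "h ` J \<subseteq> (UNIV :: 'm set)"
      using card_le_inj[OF finJ finite[of "UNIV::'m set"] cardJ] by auto
    define b where "b i = (if i \<in> h ` J then the_inv_into J h i else k)" for i
    have "b (h j) = j" if "j \<in> J" for j
      using that h(1) by (simp add: b_def the_inv_into_f_f)
    then have "J \<subseteq> range b" by (metis rangeI subsetI)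
    moreover have "range b \<subseteq> J"
      using the_inv_into_into[OF h(1)] kJ by (auto simp: b_def)
    ultimately show thesis using that by blast
  qed
  have span: "x j \<in> vec.span ((\<lambda>i. x (b i)) ` {i. b i \<le> j})" if "k \<le> j" for j
    using that
  proof (induction j rule: less_induct)
    case (less j)
    let ?S = "\<lambda>j. (\<lambda>i. x (b i)) ` {i. b i \<le> j}"
    show ?case
    proof (cases "j \<in> J")
      case True
      then obtain i where "b i = j" using b by auto
      then show ?thesis by (intro vec.span_base) auto
    next
      case False
      then have "x j \<in> vec.span (x ` {k..<j})" using less.prems by (simp add: J_def)
      moreover have "x ` {k..<j} \<subseteq> vec.span (?S j)"
      proof
        fix y assume "y \<in> x ` {k..<j}"
        then obtain l where l: "l \<in> {k..<j}" "y = x l" by auto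
        then have "y \<in> vec.span (?S l)" using less.IH by auto
        moreover have "?S l \<subseteq> ?S j" using l by auto
        ultimately show "y \<in> vec.span (?S j)" using vec.span_mono[of "?S l" "?S j"] by auto
      qed
      ultimately show ?thesis
        using vec.span_minimal[OF _ vec.subspace_span] by blast
    qed
  qed
  let ?A = "(\<chi> i. x (b i)) :: 'a ^ 'm ^ 'm"
  have det: "det ?A \<noteq> 0"
  proof -
    \<comment> \<open>A kernel vector is orthogonal to the selected vectors, hence to every
      \<open>x j\<close> with \<open>k \<le> j\<close>, and \<open>full\<close> makes it
      zero.\<close>
    have "v = 0" if "?A *v v = 0" for v
    proof (rule full)
      fix j assume j: "k \<le> j"
      let ?T = "{y. (\<Sum>i\<in>UNIV. y $ i * v $ i) = 0}"
      have "vec.subspace ?T"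
        by (auto simp: vec.subspace_def sum.distrib distrib_right sum_distrib_left[symmetric] mult.assoc)
      moreover have "x (b i) \<in> ?T" for i
        using that by (simp add: matrix_vector_mult_def vec_eq_iff)
      ultimately have "vec.span ((\<lambda>i. x (b i)) ` {i. b i \<le> j}) \<subseteq> ?T"
        by (intro vec.span_minimal) auto
      with span[OF j] show "(\<Sum>i\<in>UNIV. x j $ i * v $ i) = 0" by auto
    qed
    then show ?thesis
      by (metis invertible_det_nz invertible_left_inverse matrix_left_invertible_ker)
  qed
  have "inj b"
  proof (rule injI, rule ccontr)
    fix i j assume "b i = b j" "i \<noteq> j"
    then show False
      using det_identical_rows[of i j ?A] det by (simp add: row_def)
  qed
  moreover have "k \<le> b i" for i
    using b by (auto simp: J_def)
  ultimately show thesis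
    using kJ b span det by (intro that[of b]) auto
qed

text \<open>Column \<open>c\<close> is zero outside row \<open>i0\<close>, so in the Leibniz
  expansion only permutations sending \<open>i0\<close> to \<open>c\<close> survive. Bounding all
  \<open>fact CARD('m)\<close> summands by the same product is crude but sufficient.\<close>

lemma abs_det_le:
  fixes A :: "real ^ 'm ^ 'm::finite"
  assumes zero: "\<And>i. i \<noteq> i0 \<Longrightarrow> A $ i $ c = 0"
    and B: "\<And>i j. i \<noteq> i0 \<Longrightarrow> \<bar>A $ i $ j\<bar> \<le> B i"
  shows "\<bar>det A\<bar> \<le> fact CARD('m) * (\<bar>A $ i0 $ c\<bar> * (\<Prod>i\<in>UNIV - {i0}. B i))"
proof -
  let ?M = "\<bar>A $ i0 $ c\<bar> * (\<Prod>i\<in>UNIV - {i0}. B i)"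
  have summand: "\<bar>of_int (sign p) * (\<Prod>i\<in>UNIV. A $ i $ p i)\<bar> \<le> ?M" if p: "p permutes UNIV" for p
  proof -
    have "\<bar>of_int (sign p) * (\<Prod>i\<in>UNIV. A $ i $ p i)\<bar> = (\<Prod>i\<in>UNIV. \<bar>A $ i $ p i\<bar>)"
      by (simp add: abs_mult abs_prod sign_def)
    also have "\<dots> = \<bar>A $ i0 $ p i0\<bar> * (\<Prod>i\<in>UNIV - {i0}. \<bar>A $ i $ p i\<bar>)"
      by (rule prod.remove) auto
    also have "\<dots> \<le> ?M"
    proof (cases "p i0 = c")
      case True
      then show ?thesis
        using B by (auto intro!: mult_left_mono prod_mono)
    next
      case False
      obtain i where i: "p i = c" using p permutes_surj by (metis surjD)
      then have "i \<noteq> i0" using False by auto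
      then have "(\<Prod>i\<in>UNIV - {i0}. \<bar>A $ i $ p i\<bar>) = 0"
        using i zero by (intro prod_zero) auto
      moreover have "0 \<le> B i" if "i \<noteq> i0" for i
        using B[OF that] abs_ge_zero order_trans by blast
      then have "0 \<le> ?M" by (intro mult_nonneg_nonneg prod_nonneg) auto
      ultimately show ?thesis by (simp only: mult_zero_right)
    qed
    finally show ?thesis .
  qed
  have "\<bar>det A\<bar> \<le> (\<Sum>p\<in>{p. p permutes UNIV}. \<bar>of_int (sign p) * (\<Prod>i\<in>UNIV. A $ i $ p i)\<bar>)"
    unfolding det_def by (rule sum_abs)
  also have "\<dots> \<le> (\<Sum>p\<in>{p. p permutes (UNIV :: 'm set)}. ?M)"
    using summand by (intro sum_mono) auto
  also have "\<dots> = fact CARD('m) * ?M"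
    using card_permutations[OF refl finite[of "UNIV :: 'm set"]] by (simp only: sum_constant of_nat_fact)
  finally show ?thesis .
qed

lemma of_rat_det: "of_rat (det A) = det (\<chi> i j. (of_rat (A $ i $ j) :: 'a::field_char_0))"
  by (simp add: det_def of_rat_sum of_rat_mult of_rat_prod)

lemma det_in_Ints: "(\<And>i j. A $ i $ j \<in> \<int>) \<Longrightarrow> det A \<in> \<int>"
  unfolding det_def by (intro Ints_sum Ints_mult Ints_prod) auto

section \<open>Rational points near the hypersurface\<close>


text \<open>This is the maximum inside both \<open>omega\<close> and \<open>omega_hat\<close>, so
  either definition can be folded into statements about it.\<close>

definition approx_err :: "real ^ 'm::finite \<Rightarrow> int \<Rightarrow> int ^ 'm \<Rightarrow> real" where
  "approx_err \<theta> q a = Max (range (\<lambda>j. \<bar>of_int q * \<theta> $ j - of_int (a $ j)\<bar>))"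

lemma approx_err_ge: "\<bar>of_int q * \<theta> $ j - of_int (a $ j)\<bar> \<le> approx_err \<theta> q a"
  unfolding approx_err_def by (intro Max_ge) auto

lemma approx_err_le_iff:
  "approx_err \<theta> q a \<le> B \<longleftrightarrow> (\<forall>j. \<bar>of_int q * \<theta> $ j - of_int (a $ j)\<bar> \<le> B)"
  unfolding approx_err_def by (subst Max_le_iff) auto

lemma approx_err_nonneg: "0 \<le> approx_err \<theta> q a"
  using approx_err_ge[of q \<theta> undefined a] abs_ge_zero order_trans by blast

lemma norm_rational_point_le:
  fixes \<theta> :: "real ^ 'm::finite"
  assumes "0 < q"
  shows "norm ((\<chi> i. of_int (a $ i) / of_int q) - \<theta>) \<le> CARD('m) * approx_err \<theta> q a / of_int q"
proof -
  have "norm ((\<chi> i. of_int (a $ i) / of_int q) - \<theta>)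
      \<le> (\<Sum>i\<in>UNIV. \<bar>((\<chi> i. of_int (a $ i) / of_int q) - \<theta>) $ i\<bar>)"
    by (rule norm_le_l1_cart)
  also have "\<dots> \<le> (\<Sum>i\<in>(UNIV::'m set). approx_err \<theta> q a / of_int q)"
  proof (rule sum_mono)
    fix i :: 'm
    have "((\<chi> i. of_int (a $ i) / of_int q) - \<theta>) $ i = - (of_int q * \<theta> $ i - of_int (a $ i)) / of_int q"
      using assms by (simp add: field_simps)
    then have "\<bar>((\<chi> i. of_int (a $ i) / of_int q) - \<theta>) $ i\<bar> = \<bar>of_int q * \<theta> $ i - of_int (a $ i)\<bar> / of_int q"
      using assms by (simp only: abs_divide abs_minus_cancel abs_of_pos of_int_0_less_iff)
    also have "\<dots> \<le> approx_err \<theta> q a / of_int q"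
      using assms by (intro divide_right_mono approx_err_ge) auto
    finally show "\<bar>((\<chi> i. of_int (a $ i) / of_int q) - \<theta>) $ i\<bar> \<le> approx_err \<theta> q a / of_int q" .
  qed
  finally show ?thesis by simp
qed

section \<open>A Liouville-type lower bound for the approximation error\<close>

lemma finite_common_denominator:
  assumes "finite (S :: rat set)"
  obtains D :: int where "0 < D" "\<And>c. c \<in> S \<Longrightarrow> of_int D * c \<in> \<int>"
proof -
  have "\<exists>D::int. 0 < D \<and> (\<forall>c\<in>S. of_int D * c \<in> \<int>)"
    using assms
  proof (induction S)
    case empty
    then show ?case by (intro exI[of _ 1]) simp
  next
    case (insert c S)
    then obtain D :: int where D: "0 < D" "\<forall>c\<in>S. of_int D * c \<in> \<int>" by blast
    obtain u v where uv: "quotient_of c = (u, v)" by force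
    then have v: "0 < v" "c = of_int u / of_int v"
      using quotient_of_denom_pos quotient_of_div by blast+
    have "of_int (v * D) * c = of_int (D * u)" using v by simp
    moreover have "of_int (v * D) * c' \<in> \<int>" if "c' \<in> S" for c'
    proof -
      have "of_int (v * D) * c' = of_int v * (of_int D * c')" by simp
      then show ?thesis using D(2) that by (metis Ints_mult Ints_of_int)
    qed
    ultimately have "\<forall>c'\<in>insert c S. of_int (v * D) * c' \<in> \<int>"
      by (metis Ints_of_int insert_iff)
    moreover have "0 < v * D" using v(1) D(1) by simp
    ultimately show ?case by blast
  qed
  then show thesis using that by blast
qed

lemma sum_lookup_le_total_degree:
  assumes "m \<in> Poly_Mapping.keys f"
  shows "(\<Sum>i\<in>UNIV. Poly_Mapping.lookup m i) \<le> total_degree f"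
  unfolding total_degree_def using assms by (intro Max_ge) auto

text \<open>\<open>D\<close> clears the coefficients, and the power of \<open>q\<close> clears each
  monomial because no monomial exceeds the total degree. The point is that \<open>D\<close> depends
  on \<open>f\<close> alone.\<close>

lemma mpoly_eval_common_denominator:
  fixes f :: "('n::finite, rat) mpoly"
  obtains D :: int where "0 < D"
    "\<And>q (a :: int ^ 'n). 0 < q \<Longrightarrow>
      of_int D * of_int q ^ total_degree f * mpoly_eval f (\<chi> i. real_of_int (a $ i) / of_int q) \<in> \<int>"
proof -
  obtain D :: int where D: "0 < D"
      "\<And>c. c \<in> Poly_Mapping.lookup f ` Poly_Mapping.keys f \<Longrightarrow> of_int D * c \<in> \<int>"
    using finite_common_denominator[of "Poly_Mapping.lookup f ` Poly_Mapping.keys f"] by auto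
  have "of_int D * of_int q ^ total_degree f * mpoly_eval f (\<chi> i. real_of_int (a $ i) / of_int q) \<in> \<int>"
    if q: "0 < q" for q and a :: "int ^ 'n"
    unfolding mpoly_eval_def sum_distrib_left
  proof (rule Ints_sum)
    fix m assume m: "m \<in> Poly_Mapping.keys f"
    let ?l = "Poly_Mapping.lookup m" and ?c = "Poly_Mapping.lookup f m"
    let ?k = "\<Sum>i\<in>UNIV. ?l i"
    have "(of_int q :: real) ^ total_degree f = of_int q ^ (total_degree f - ?k) * of_int q ^ ?k"
      using sum_lookup_le_total_degree[OF m] by (simp add: power_add[symmetric])
    moreover have "(\<Prod>i\<in>UNIV. ((\<chi> i. real_of_int (a $ i) / of_int q) $ i) ^ ?l i)
        = (\<Prod>i\<in>UNIV. of_int (a $ i) ^ ?l i) / of_int q ^ ?k"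
      by (simp add: power_divide prod_dividef power_sum)
    ultimately have "of_int D * of_int q ^ total_degree f
        * (of_rat ?c * (\<Prod>i\<in>UNIV. ((\<chi> i. real_of_int (a $ i) / of_int q) $ i) ^ ?l i))
      = of_rat (of_int D * ?c) * of_int (q ^ (total_degree f - ?k) * (\<Prod>i\<in>UNIV. (a $ i) ^ ?l i))"
      using q by (simp add: of_rat_mult field_simps)
    moreover have "(of_rat (of_int D * ?c) :: real) \<in> \<int>"
    proof -
      obtain z where "of_int D * ?c = of_int z" using D(2) m by (metis Ints_cases imageI)
      then show ?thesis by simp
    qed
    ultimately show "of_int D * of_int q ^ total_degree f
        * (of_rat ?c * (\<Prod>i\<in>UNIV. ((\<chi> i. real_of_int (a $ i) / of_int q) $ i) ^ ?l i)) \<in> \<int>"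
      by (metis Ints_mult Ints_of_int)
  qed
  with D(1) show thesis using that by blast
qed

lemma mpoly_eval_of_rat:
  fixes f :: "('n::finite, rat) mpoly"
  shows "mpoly_eval f (\<chi> i. real_of_rat (y $ i)) = of_rat (mpoly_eval f y)"
  by (simp add: mpoly_eval_def of_rat_sum of_rat_mult of_rat_prod of_rat_power)

text \<open>Differentiability at \<open>x\<close>: near \<open>x\<close> the linearisation error is
  at most \<open>norm (y - x)\<close>, and the derivative is bounded by some \<open>B\<close>, so
  \<open>K = 1 + B\<close> works.\<close>

lemma mpoly_eval_locally_lipschitz:
  fixes f :: "('n::finite, rat) mpoly" and x :: "real ^ 'n"
  obtains K d where "0 < K" "0 < d"
    "\<And>y. norm (y - x) < d \<Longrightarrow> \<bar>mpoly_eval f y - mpoly_eval f x\<bar> \<le> K * norm (y - x)"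
proof -
  have "real_polynomial_function (\<lambda>x :: real ^ 'n. x $ i)" for i
    by (rule real_polynomial_function.intros(1)) (rule bounded_linear_vec_nth)
  then have "real_polynomial_function (mpoly_eval f :: real ^ 'n \<Rightarrow> real)"
    unfolding mpoly_eval_def[abs_def]
    by (intro real_polynomial_function_sum real_polynomial_function.intros(2,4)
        real_polynomial_function_prod real_polynomial_function_power) auto
  then obtain f' where f': "(mpoly_eval f has_derivative f') (at x)"
    using differentiable_at_real_polynomial_function unfolding differentiable_def by blast
  then have "bounded_linear f'"
    "\<exists>d>0. \<forall>y. norm (y - x) < d \<longrightarrow> norm (mpoly_eval f y - mpoly_eval f x - f' (y - x)) \<le> 1 * norm (y - x)"
    unfolding has_derivative_at_alt using zero_less_one by blast+
  then obtain B d where B: "\<And>v. norm (f' v) \<le> norm v * B" and "0 < B" and d: "0 < d"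
      "\<And>y. norm (y - x) < d \<Longrightarrow> norm (mpoly_eval f y - mpoly_eval f x - f' (y - x)) \<le> norm (y - x)"
    using bounded_linear.pos_bounded by force
  have "\<bar>mpoly_eval f y - mpoly_eval f x\<bar> \<le> (1 + B) * norm (y - x)" if "norm (y - x) < d" for y
    using d(2)[OF that] B[of "y - x"] by (simp add: algebra_simps)
  with \<open>0 < B\<close> d(1) show thesis by (intro that[of "1 + B" d]) auto
qed

text \<open>A point \<open>p = a/q\<close> far from \<xi> has a large error anyway. A near one is no
  rational solution, so \<open>mpoly_eval f p - 1\<close> is a nonzero multiple of
  \<open>1 / (D q^s)\<close>, while the Lipschitz bound makes it at most a constant times
  \<open>approx_err \<xi> q a / q\<close>. The \<open>q\<close> in that denominator improves the
  exponent from s to s - 1.\<close>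

proposition liouville_bound:
  fixes f :: "('n::finite, rat) mpoly" and \<xi> :: "real ^ 'n"
  assumes deg: "1 \<le> total_degree f"
    and fin: "finite {x :: rat ^ 'n. mpoly_eval f x = 1}"
    and irr: "\<not> (\<forall>i. \<xi> $ i \<in> \<rat>)"
    and root: "mpoly_eval f \<xi> = 1"
  obtains c where "0 < c"
    "\<And>q a. 0 < q \<Longrightarrow> c * of_int q powr (- (real (total_degree f) - 1)) \<le> approx_err \<xi> q a"
proof -
  define s where "s = total_degree f"
  define N where "N = real CARD('n)"
  have N: "0 < N" by (simp add: N_def)
  obtain D :: int where D: "0 < D"
    "\<And>q (a :: int ^ 'n). 0 < q \<Longrightarrow>
      of_int D * of_int q ^ s * mpoly_eval f (\<chi> i. real_of_int (a $ i) / of_int q) \<in> \<int>"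
    using mpoly_eval_common_denominator s_def by metis
  obtain K d1 where K: "0 < K" "0 < d1"
    "\<And>y. norm (y - \<xi>) < d1 \<Longrightarrow> \<bar>mpoly_eval f y - mpoly_eval f \<xi>\<bar> \<le> K * norm (y - \<xi>)"
    using mpoly_eval_locally_lipschitz by metis
  \<comment> \<open>The rational solutions seen as real points: finitely many, and not containing
    the irrational \<xi>, so they keep a distance \<open>d2\<close> from it.\<close>
  define S where "S = (\<lambda>y. \<chi> i. real_of_rat (y $ i)) ` {x :: rat ^ 'n. mpoly_eval f x = 1}"
  have "finite S" using fin by (simp add: S_def)
  then obtain d2 where d2: "0 < d2" "\<And>y. y \<in> S \<Longrightarrow> y \<noteq> \<xi> \<Longrightarrow> d2 \<le> dist \<xi> y"
    using finite_set_avoid by metis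
  have "\<xi> \<notin> S" using irr by (auto simp: S_def)
  define d where "d = min d1 d2"
  \<comment> \<open>The first term serves the points at distance at least \<open>d\<close>, the
    second the nearer ones.\<close>
  define c where "c = min (d / N) (1 / (of_int D * K * N))"
  have c: "0 < c" using N D(1) K(1,2) d2(1) by (simp add: c_def d_def)
  have "c * of_int q powr (- (real s - 1)) \<le> approx_err \<xi> q a" if q: "0 < q" for q and a :: "int ^ 'n"
  proof -
    define p where "p = (\<chi> i. real_of_int (a $ i) / of_int q)"
    let ?E = "approx_err \<xi> q a"
    have pE: "norm (p - \<xi>) \<le> N * ?E / of_int q"
      unfolding p_def N_def by (rule norm_rational_point_le[OF q])
    have pw: "of_int q powr (real s - 1) = (of_int q :: real) ^ (s - 1)"
      using deg q by (simp add: powr_realpow[symmetric] s_def of_nat_diff)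
    have pwm: "of_int q powr (- (real s - 1)) = 1 / (of_int q :: real) ^ (s - 1)"
      by (simp only: powr_minus_divide pw)
    have q1: "1 \<le> (of_int q :: real) ^ (s - 1)" using q by (intro one_le_power) simp
    show ?thesis
    proof (cases "norm (p - \<xi>) < d")
      case False
      then have "d \<le> N * ?E / of_int q" using pE by simp
      also have "\<dots> \<le> N * ?E / 1"
        using q N approx_err_nonneg[of \<xi> q a] by (intro divide_left_mono) auto
      finally have "d / N \<le> ?E" using N by (simp add: field_simps)
      then have "c \<le> ?E" by (simp add: c_def)
      moreover have "c * of_int q powr (- (real s - 1)) \<le> c * 1"
        unfolding pwm using q1 c by (intro mult_left_mono) auto
      ultimately show ?thesis by simp
    next
      case True
      have "p \<notin> S"
      proof
        assume "p \<in> S"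
        with \<open>\<xi> \<notin> S\<close> have "d2 \<le> dist \<xi> p" using d2(2) by metis
        with True show False by (simp add: d_def dist_norm norm_minus_commute)
      qed
      have "mpoly_eval f p \<noteq> 1"
      proof
        assume 1: "mpoly_eval f p = 1"
        define y :: "rat ^ 'n" where "y = (\<chi> i. of_int (a $ i) / of_int q)"
        have py: "p = (\<chi> i. of_rat (y $ i))" by (simp add: p_def y_def of_rat_divide)
        with 1 have "mpoly_eval f y = 1" by (simp add: mpoly_eval_of_rat)
        with py \<open>p \<notin> S\<close> show False by (auto simp: S_def)
      qed
      then have nz: "of_int D * of_int q ^ s * (mpoly_eval f p - 1) \<noteq> 0" using D(1) q by simp
      have "of_int D * of_int q ^ s * (mpoly_eval f p - 1)
          = of_int D * of_int q ^ s * mpoly_eval f p - of_int (D * q ^ s)"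
        by (simp add: algebra_simps)
      then have "of_int D * of_int q ^ s * (mpoly_eval f p - 1) \<in> \<int>"
        using D(2)[OF q, of a] by (simp only: p_def Ints_diff Ints_of_int)
      with nz have "1 \<le> \<bar>of_int D * of_int q ^ s * (mpoly_eval f p - 1)\<bar>"
        using Ints_nonzero_abs_ge1 by blast
      also have "\<dots> = of_int D * of_int q ^ s * \<bar>mpoly_eval f p - 1\<bar>"
        using D(1) q by (simp add: abs_mult)
      also have "\<dots> \<le> of_int D * of_int q ^ s * (K * (N * ?E / of_int q))"
      proof (intro mult_left_mono)
        have "\<bar>mpoly_eval f p - 1\<bar> \<le> K * norm (p - \<xi>)"
          using K(3)[of p] True root by (simp add: d_def)
        also have "\<dots> \<le> K * (N * ?E / of_int q)" using K(1) pE by (intro mult_left_mono) auto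
        finally show "\<bar>mpoly_eval f p - 1\<bar> \<le> K * (N * ?E / of_int q)" .
      qed (use D(1) q in auto)
      also have "of_int q ^ s = of_int q * (of_int q :: real) ^ (s - 1)"
        using deg by (simp add: s_def power_eq_if)
      finally have "1 \<le> (of_int D * K * N) * (?E * of_int q ^ (s - 1))"
        using q by (simp add: field_simps)
      then have "1 / (of_int D * K * N) \<le> ?E * of_int q ^ (s - 1)"
        using D(1) K(1) N by (simp add: field_simps)
      then have "c \<le> ?E * of_int q ^ (s - 1)" by (simp add: c_def)
      then show ?thesis unfolding pwm using q by (simp add: field_simps)
    qed
  qed
  with c show thesis using that s_def by blast
qed

section \<open>From the lower bound to the ordinary exponent\<close>

lemma finite_bounded_int_vectors: "finite {a :: int ^ 'n::finite. \<forall>j. \<bar>a $ j\<bar> \<le> B j}"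
proof -
  have "finite (Pi\<^sub>E UNIV (\<lambda>j. {- B j..B j}))" by (intro finite_PiE) auto
  moreover have "{a :: int ^ 'n. \<forall>j. \<bar>a $ j\<bar> \<le> B j} \<subseteq> vec_lambda ` Pi\<^sub>E UNIV (\<lambda>j. {- B j..B j})"
  proof
    fix a :: "int ^ 'n" assume "a \<in> {a. \<forall>j. \<bar>a $ j\<bar> \<le> B j}"
    then have "vec_nth a \<in> Pi\<^sub>E UNIV (\<lambda>j. {- B j..B j})" by (auto simp: abs_le_iff minus_le_iff)
    then show "a \<in> vec_lambda ` Pi\<^sub>E UNIV (\<lambda>j. {- B j..B j})"
      by (metis imageI vec_nth_inverse)
  qed
  ultimately show ?thesis by (rule finite_surj)
qed

text \<open>For an exponent \<gamma> > t the two bounds on the error confine \<open>q\<close> to a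
  bounded range, and an error of at most 1 then confines \<open>a\<close>, so only finitely many
  solutions remain.\<close>

lemma omega_le_if_approx_err_ge:
  fixes \<theta> :: "real ^ 'm::finite"
  assumes c: "0 < c" "\<And>q a. 0 < q \<Longrightarrow> c * of_int q powr (- t) \<le> approx_err \<theta> q a"
    and t: "0 \<le> t"
  shows "omega \<theta> \<le> ereal t"
  unfolding omega_def approx_err_def[symmetric]
proof (rule Sup_least)
  fix z assume "z \<in> {ereal \<gamma> | \<gamma>. infinite {(q, a). 0 < q \<and> approx_err \<theta> q a < of_int q powr (- \<gamma>)}}"
  then obtain \<gamma> where z: "z = ereal \<gamma>"
    and inf: "infinite {(q, a). 0 < q \<and> approx_err \<theta> q a < of_int q powr (- \<gamma>)}" (is "infinite ?S")
    by auto
  have "\<gamma> \<le> t"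
  proof (rule ccontr)
    assume "\<not> \<gamma> \<le> t"
    then have gt: "t < \<gamma>" by simp
    \<comment> \<open>Solves \<open>q powr (\<gamma> - t) = 1 / c\<close> for
      \<open>q\<close>.\<close>
    define B where "B = (1 / c) powr (1 / (\<gamma> - t))"
    have qB: "of_int q \<le> B" and aB: "\<forall>j. \<bar>a $ j\<bar> \<le> \<lceil>B * \<bar>\<theta> $ j\<bar> + 1\<rceil>" if "(q, a) \<in> ?S" for q a
    proof -
      from that have q: "0 < q" and e: "approx_err \<theta> q a < of_int q powr (- \<gamma>)" by auto
      from c(2)[OF q] e have "c * of_int q powr (- t) < of_int q powr (- \<gamma>)"
        using le_less_trans by blast
      then have "c * of_int q powr (- t) * of_int q powr \<gamma> < of_int q powr (- \<gamma>) * of_int q powr \<gamma>"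
        using q by (intro mult_strict_right_mono) auto
      then have "c * of_int q powr (\<gamma> - t) < 1"
        using q by (simp add: powr_add[symmetric] mult.assoc)
      then have "of_int q powr (\<gamma> - t) < 1 / c" using c(1) by (simp add: field_simps)
      then have "(of_int q powr (\<gamma> - t)) powr (1 / (\<gamma> - t)) \<le> B"
        unfolding B_def using gt by (intro powr_mono2) auto
      then show qB: "of_int q \<le> B" using q gt by (simp add: powr_powr)
      \<comment> \<open>Here t \<ge> 0 enters: it makes \<gamma> positive.\<close>
      have "approx_err \<theta> q a \<le> 1"
      proof -
        have "of_int q powr (- \<gamma>) \<le> 1"
          using q gt t by (simp add: powr_minus_divide ge_one_powr_ge_zero)
        with e show ?thesis by simp
      qed
      then have "\<bar>of_int (a $ j)\<bar> \<le> B * \<bar>\<theta> $ j\<bar> + 1" for j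
      proof -
        have "\<bar>of_int (a $ j) :: real\<bar> \<le> \<bar>of_int q * \<theta> $ j\<bar> + \<bar>of_int q * \<theta> $ j - of_int (a $ j)\<bar>" by linarith
        also have "\<dots> \<le> of_int q * \<bar>\<theta> $ j\<bar> + 1"
          using approx_err_ge[of q \<theta> j a] \<open>approx_err \<theta> q a \<le> 1\<close> q by (simp add: abs_mult)
        also have "\<dots> \<le> B * \<bar>\<theta> $ j\<bar> + 1" using qB by (simp add: mult_right_mono)
        finally show ?thesis .
      qed
      then have "real_of_int \<bar>a $ j\<bar> \<le> of_int \<lceil>B * \<bar>\<theta> $ j\<bar> + 1\<rceil>" for j
        using le_of_int_ceiling order_trans unfolding of_int_abs by blast
      then show "\<forall>j. \<bar>a $ j\<bar> \<le> \<lceil>B * \<bar>\<theta> $ j\<bar> + 1\<rceil>"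
        unfolding of_int_le_iff by blast
    qed
    have "?S \<subseteq> {0..\<lfloor>B\<rfloor>} \<times> {a. \<forall>j. \<bar>a $ j\<bar> \<le> \<lceil>B * \<bar>\<theta> $ j\<bar> + 1\<rceil>}"
      using qB aB by (auto simp: le_floor_iff)
    then have "finite ?S"
      by (rule finite_subset) (intro finite_cartesian_product finite_bounded_int_vectors, simp)
    with inf show False by simp
  qed
  then show "z \<le> ereal t" by (simp add: z)
qed

section \<open>Best approximations\<close>


text \<open>The \<open>q j\<close> are the successive record denominators. No denominator below
  \<open>q (Suc j)\<close> beats the error at \<open>q j\<close>, so a solution of the uniform
  system with Q just below \<open>q (Suc j)\<close> forces that error to be at most
  \<open>Q powr (- \<gamma>)\<close>. Positivity of all errors keeps the records from
  ending.\<close>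

lemma best_approximations:
  fixes \<theta> :: "real ^ 'm::finite"
  assumes pos: "\<And>q a. 0 < q \<Longrightarrow> 0 < approx_err \<theta> q a"
    and \<gamma>: "0 < \<gamma>"
    and ev: "\<forall>\<^sub>F Q :: real in at_top. \<exists>(q :: int) (a :: int ^ 'm). 1 \<le> q \<and> of_int q \<le> Q \<and>
       approx_err \<theta> q a < Q powr (- \<gamma>)"
  obtains q :: "nat \<Rightarrow> nat" and a :: "nat \<Rightarrow> int ^ 'm" and k where
    "strict_mono q" "\<And>j. 1 \<le> q j"
    "\<And>j. approx_err \<theta> (q (Suc j)) (a (Suc j)) \<le> approx_err \<theta> (q j) (a j)"
    "\<And>j. k \<le> j \<Longrightarrow> approx_err \<theta> (q j) (a j) \<le> q (Suc j) powr (- \<gamma>)"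
proof -
  \<comment> \<open>Rounding every coordinate gives the best numerators for the denominator
    \<open>n\<close>; only \<open>n\<close> is left to vary.\<close>
  define r :: "nat \<Rightarrow> int ^ 'm" where "r n = (\<chi> j. round (real n * \<theta> $ j))" for n
  define e where "e n = approx_err \<theta> (int n) (r n)" for n
  have e_le: "e n \<le> approx_err \<theta> (int n) a" for n a
    unfolding e_def approx_err_le_iff
  proof
    fix j
    have "\<bar>of_int (int n) * \<theta> $ j - of_int (r n $ j)\<bar> \<le> \<bar>of_int (int n) * \<theta> $ j - of_int (a $ j)\<bar>"
      using round_diff_minimal[of "real n * \<theta> $ j" "a $ j"] by (simp add: r_def)
    also have "\<dots> \<le> approx_err \<theta> (int n) a" by (rule approx_err_ge)
    finally show "\<bar>of_int (int n) * \<theta> $ j - of_int (r n $ j)\<bar> \<le> approx_err \<theta> (int n) a" .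
  qed
  obtain Q0 where Q0: "\<And>Q. Q0 \<le> Q \<Longrightarrow> \<exists>n. 1 \<le> n \<and> real n \<le> Q \<and> e n < Q powr (- \<gamma>)"
  proof -
    obtain Q0 where "\<And>Q. Q0 \<le> Q \<Longrightarrow> \<exists>(q :: int) (a :: int ^ 'm). 1 \<le> q \<and> of_int q \<le> Q \<and>
       approx_err \<theta> q a < Q powr (- \<gamma>)"
      using ev unfolding eventually_at_top_linorder by blast
    then have "\<exists>n. 1 \<le> n \<and> real n \<le> Q \<and> e n < Q powr (- \<gamma>)" if "Q0 \<le> Q" for Q
    proof -
      obtain p :: int and a :: "int ^ 'm" where p: "1 \<le> p" "of_int p \<le> Q" "approx_err \<theta> p a < Q powr (- \<gamma>)"
        using \<open>\<And>Q. Q0 \<le> Q \<Longrightarrow> _\<close>[OF \<open>Q0 \<le> Q\<close>] by blast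
      then have "int (nat p) = p" by simp
      with p e_le[of "nat p" a] show ?thesis
        by (intro exI[of _ "nat p"]) auto
    qed
    then show thesis by (rule that)
  qed
  \<comment> \<open>\<open>P n\<close> marks a record denominator, and \<open>R n p\<close> says
    that \<open>p\<close> is the first denominator to beat it.\<close>
  define P where "P n \<longleftrightarrow> 1 \<le> n \<and> (\<forall>n'. 1 \<le> n' \<longrightarrow> n' \<le> n \<longrightarrow> e n \<le> e n')" for n
  define R where "R n p \<longleftrightarrow> n < p \<and> e p < e n \<and> (\<forall>n'. 1 \<le> n' \<longrightarrow> n' < p \<longrightarrow> e n \<le> e n')" for n p
  have better: "\<exists>n'. 1 \<le> n' \<and> e n' < e n" if "1 \<le> n" for n
  proof -
    have "0 < e n" using pos[of "int n" "r n"] that by (simp add: e_def)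
    moreover have "((\<lambda>Q. Q powr (- \<gamma>)) \<longlongrightarrow> 0) at_top"
      using \<gamma> by (intro tendsto_neg_powr filterlim_ident) auto
    ultimately have "\<forall>\<^sub>F Q in at_top. Q powr (- \<gamma>) < e n"
      by (simp add: order_tendstoD(2))
    then have "\<forall>\<^sub>F Q in at_top. Q powr (- \<gamma>) < e n \<and> Q0 \<le> Q"
      by (rule eventually_conj[OF _ eventually_ge_at_top])
    from eventually_happens'[OF trivial_limit_at_top_linorder this]
    obtain Q where Q: "Q powr (- \<gamma>) < e n" "Q0 \<le> Q" by auto
    then obtain n' where "1 \<le> n'" "e n' < Q powr (- \<gamma>)" using Q0 by metis
    with Q(1) show ?thesis by (intro exI[of _ n']) simp
  qed
  have "\<exists>q. \<forall>j. P (q j) \<and> R (q j) (q (Suc j))"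
  proof (rule dependent_nat_choice)
    show "\<exists>n. P n" by (rule exI[of _ 1]) (auto simp: P_def)
  next
    fix n assume Pn: "P n"
    define p where "p = (LEAST n'. 1 \<le> n' \<and> e n' < e n)"
    have p: "1 \<le> p" "e p < e n"
      using LeastI_ex[OF better[of n]] Pn by (auto simp: p_def P_def)
    have min: "e n \<le> e n'" if "1 \<le> n'" "n' < p" for n'
      using not_less_Least[of n' "\<lambda>n'. 1 \<le> n' \<and> e n' < e n"] that by (auto simp: p_def)
    have "n < p"
      using p Pn by (metis P_def leD le_less_linear)
    then have "R n p" using p min by (simp add: R_def)
    moreover have "P p"
      unfolding P_def
    proof (intro conjI allI impI)
      fix n' assume "1 \<le> n'" "n' \<le> p"
      then show "e p \<le> e n'" using min[of n'] p by (cases "n' = p") auto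
    qed (rule p)
    ultimately show "\<exists>p. P p \<and> R n p" by blast
  qed
  then obtain q where q: "\<And>j. P (q j)" "\<And>j. R (q j) (q (Suc j))" by blast
  show thesis
  proof (rule that[of q "\<lambda>j. r (q j)" "nat \<lceil>Q0\<rceil>"])
    show sm: "strict_mono q" using q(2) by (simp add: strict_mono_Suc_iff R_def)
    show "1 \<le> q j" for j using q(1) by (simp add: P_def)
    show "approx_err \<theta> (int (q (Suc j))) (r (q (Suc j))) \<le> approx_err \<theta> (int (q j)) (r (q j))" for j
      using q(2)[of j] by (simp add: R_def e_def)
    fix j assume j: "nat \<lceil>Q0\<rceil> \<le> j"
    have "j < q (Suc j)" using sm by (meson Suc_le_lessD strict_mono_imp_increasing)
    with j have Q0q: "Q0 < q (Suc j)" by linarith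
    have qp: "0 < real (q (Suc j))" using \<open>j < q (Suc j)\<close> by simp
    \<comment> \<open>For Q equal to \<open>q (Suc j)\<close> the solution could be the new record
      itself. The hypothesis is therefore used strictly below, and the bound at the endpoint is
      reached by a left limit.\<close>
    have less: "e (q j) \<le> Q powr (- \<gamma>)" if Q: "Q0 \<le> Q" "Q < q (Suc j)" for Q
    proof -
      obtain n where n: "1 \<le> n" "real n \<le> Q" "e n < Q powr (- \<gamma>)" using Q0[OF Q(1)] by auto
      then have "n < q (Suc j)" using Q(2) by linarith
      then have "e (q j) \<le> e n" using q(2)[of j] n(1) by (simp add: R_def)
      with n(3) show ?thesis by simp
    qed
    have "((\<lambda>Q. Q powr (- \<gamma>)) \<longlongrightarrow> q (Suc j) powr (- \<gamma>)) (at_left (real (q (Suc j))))"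
      using qp by (intro tendsto_intros) auto
    moreover have "\<forall>\<^sub>F Q in at_left (real (q (Suc j))). e (q j) \<le> Q powr (- \<gamma>)"
      using eventually_at_left_real[OF Q0q] by eventually_elim (use less in auto)
    ultimately have "e (q j) \<le> q (Suc j) powr (- \<gamma>)"
      by (rule tendsto_lowerbound) simp
    then show "approx_err \<theta> (int (q j)) (r (q j)) \<le> q (Suc j) powr (- \<gamma>)"
      by (simp add: e_def)
  qed
qed

text \<open>This makes every tail of approximation vectors span the whole space. After clearing
  denominators in \<open>v\<close>, orthogonality writes \<open>L * q j\<close>, for the integer
  form \<open>L\<close> in 1 and \<theta>, as a combination of bounded errors. Since
  \<open>q j\<close> is unbounded, \<open>L = 0\<close>, and total irrationality applies. The index
  \<open>None\<close> holds the denominator coordinate.\<close>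

lemma annihilator_of_approximations_eq_0:
  fixes \<theta> :: "real ^ 'm::finite" and q :: "nat \<Rightarrow> nat" and a :: "nat \<Rightarrow> int ^ 'm" and v :: "rat ^ 'm option"
  assumes irr: "totally_irrational \<theta>"
    and q: "strict_mono q"
    and E: "\<And>j. approx_err \<theta> (q j) (a j) \<le> E"
    and ann: "\<And>j. k \<le> j \<Longrightarrow> (\<Sum>i\<in>UNIV. (case i of None \<Rightarrow> of_nat (q j) | Some i \<Rightarrow> of_int (a j $ i)) * v $ i) = 0"
  shows "v = 0"
proof -
  obtain D :: int where D: "0 < D" "\<And>c. c \<in> range (($) v) \<Longrightarrow> of_int D * c \<in> \<int>"
    using finite_common_denominator[of "range (($) v)"] by auto
  define u where "u i = \<lfloor>of_int D * v $ i\<rfloor>" for i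
  have u: "of_int (u i) = of_int D * v $ i" for i
    using D(2)[of "v $ i"] by (simp add: u_def)
  define L where "L = of_int (u None) + (\<Sum>i\<in>UNIV. of_int (u (Some i)) * \<theta> $ i)"
  have sum_option: "(\<Sum>i\<in>UNIV. F i) = F None + (\<Sum>i\<in>UNIV. F (Some i))" for F :: "'m option \<Rightarrow> 'b::comm_monoid_add"
    by (simp add: UNIV_option_conv sum.reindex)
  have int0: "u None * int (q j) + (\<Sum>i\<in>UNIV. u (Some i) * a j $ i) = 0" if "k \<le> j" for j
  proof -
    have "rat_of_int (u None * int (q j) + (\<Sum>i\<in>UNIV. u (Some i) * a j $ i))
        = of_int D * (\<Sum>i\<in>UNIV. (case i of None \<Rightarrow> of_nat (q j) | Some i \<Rightarrow> of_int (a j $ i)) * v $ i)"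
      by (simp add: u sum_option distrib_left sum_distrib_left mult_ac)
    then show ?thesis using ann[OF that] by (simp only: mult_zero_right of_int_eq_0_iff)
  qed
  define K where "K = (\<Sum>i\<in>UNIV. \<bar>real_of_int (u (Some i))\<bar>) * E"
  have bound: "\<bar>L\<bar> * real (q j) \<le> K" if "k \<le> j" for j
  proof -
    have "real_of_int (u None * int (q j) + (\<Sum>i\<in>UNIV. u (Some i) * a j $ i)) = 0"
      using int0[OF that] by (simp only: of_int_0)
    then have "L * real (q j) = (\<Sum>i\<in>UNIV. of_int (u (Some i)) * (of_int (int (q j)) * \<theta> $ i - of_int (a j $ i)))"
      by (simp add: L_def algebra_simps sum_distrib_left sum_subtractf)
    then have "\<bar>L\<bar> * real (q j) = \<bar>\<Sum>i\<in>UNIV. of_int (u (Some i)) * (of_int (int (q j)) * \<theta> $ i - of_int (a j $ i))\<bar>"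
      by (metis abs_mult abs_of_nat)
    also have "\<dots> \<le> (\<Sum>i\<in>UNIV. \<bar>of_int (u (Some i)) * (of_int (int (q j)) * \<theta> $ i - of_int (a j $ i))\<bar>)"
      by (rule sum_abs)
    also have "\<dots> \<le> (\<Sum>i\<in>UNIV. \<bar>real_of_int (u (Some i))\<bar> * E)"
    proof (rule sum_mono)
      fix i
      have "\<bar>of_int (int (q j)) * \<theta> $ i - of_int (a j $ i)\<bar> \<le> E"
        using approx_err_ge E by (rule order_trans)
      then show "\<bar>of_int (u (Some i)) * (of_int (int (q j)) * \<theta> $ i - of_int (a j $ i))\<bar>
          \<le> \<bar>real_of_int (u (Some i))\<bar> * E"
        unfolding abs_mult by (rule mult_left_mono) simp
    qed
    finally show ?thesis by (simp add: K_def sum_distrib_right)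
  qed
  have "L = 0"
  proof (rule ccontr)
    assume "L \<noteq> 0"
    obtain n :: nat where n: "K / \<bar>L\<bar> < n" using reals_Archimedean2 by blast
    have "max n k \<le> q (max n k)" using q by (rule strict_mono_imp_increasing)
    then have "real n \<le> q (max n k)" by linarith
    with n have "K / \<bar>L\<bar> < q (max n k)" by linarith
    with bound[of "max n k"] \<open>L \<noteq> 0\<close> show False by (simp add: field_simps)
  qed
  then have "u None = 0 \<and> (\<chi> i. u (Some i)) = (0 :: int ^ 'm)"
    using irr[unfolded totally_irrational_def, rule_format, of "u None" "\<chi> i. u (Some i)"]
    by (simp add: L_def)
  then have "u i = 0" for i
    by (cases i) (auto simp: vec_eq_iff)
  then have "v $ i = 0" for i
    using u[of i] D(1) by simp
  then show ?thesis by (simp add: vec_eq_iff)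
qed

text \<open>\<open>J\<close> consists of the selected indices after \<open>k\<close>. Once the rows
  are reduced, the \<open>None\<close> column has only the entry \<open>q k\<close>, and each
  \<open>j\<close> in \<open>J\<close> contributes the bound for the remaining entries of its
  row.\<close>

proposition approximation_determinant_bound:
  fixes \<theta> :: "real ^ 'm::finite" and q :: "nat \<Rightarrow> nat" and a :: "nat \<Rightarrow> int ^ 'm"
    and E :: "nat \<Rightarrow> real"
  defines "E \<equiv> \<lambda>j. approx_err \<theta> (q j) (a j)"
  assumes irr: "totally_irrational \<theta>"
    and q: "strict_mono q" "\<And>j. 1 \<le> q j"
    and E: "\<And>j. E (Suc j) \<le> E j"
  obtains J where "finite J" "J \<subseteq> {k<..}" "card J = CARD('m)"
    "1 \<le> fact (Suc CARD('m)) * (q k * (\<Prod>j\<in>J. 2 * q j * E (j - 1) / q (j - 1)))"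
proof -
  define x :: "nat \<Rightarrow> rat ^ 'm option" where
    "x j = (\<chi> i. case i of None \<Rightarrow> of_nat (q j) | Some i \<Rightarrow> of_int (a j $ i))" for j
  have "decseq E" using E by (simp add: decseq_Suc_iff)
  then have E0: "E j \<le> E 0" for j by (simp add: decseqD)
  have full: "v = 0" if "\<And>j. k \<le> j \<Longrightarrow> (\<Sum>i\<in>UNIV. x j $ i * v $ i) = 0" for v
    using annihilator_of_approximations_eq_0[OF irr q(1), of a "E 0" k v] E0 that
    by (simp add: E_def x_def)
  have "x k $ None \<noteq> 0" using q(2)[of k] by (simp add: x_def)
  then have "x k \<noteq> 0" by auto
  from greedy_basis[of k x, OF full this] obtain b :: "'m option \<Rightarrow> nat" where
    b: "inj b" "k \<in> range b" "\<And>i. k \<le> b i"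
    and span: "\<And>j. k \<le> j \<Longrightarrow> x j \<in> vec.span ((\<lambda>i. x (b i)) ` {i. b i \<le> j})"
    and nz: "det (\<chi> i. x (b i)) \<noteq> 0" by metis
  obtain i0 where i0: "b i0 = k" using b(2) by auto
  have gt: "k < b i" if "i \<noteq> i0" for i
    using b(1) b(3)[of i] i0 that by (metis injD le_neq_implies_less)
  define t where "t j = (of_nat (q j) / of_nat (q (j - 1)) :: rat)" for j
  \<comment> \<open>The vector subtracted has index \<open>b i - 1\<close>, selected or not: it lies
    in the span of the selected vectors before \<open>b i\<close>, and the factor \<open>t\<close>
    cancels the \<open>None\<close> coordinate.\<close>
  define w where "w i = (if i = i0 then x k else x (b i) - t (b i) *s x (b i - 1))" for i
  have "w i - x (b i) \<in> vec.span ((\<lambda>i. x (b i)) ` {j. b j < b i})" for i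
  proof (cases "i = i0")
    case True
    then show ?thesis by (simp add: w_def i0 vec.span_zero)
  next
    case False
    then have "{j. b j \<le> b i - 1} = {j. b j < b i}" using gt[OF False] by auto
    then have "x (b i - 1) \<in> vec.span ((\<lambda>i. x (b i)) ` {j. b j < b i})"
      using span[of "b i - 1"] gt[OF False] by simp
    then have "- (t (b i) *s x (b i - 1)) \<in> vec.span ((\<lambda>i. x (b i)) ` {j. b j < b i})"
      by (intro vec.span_neg vec.span_scale)
    then show ?thesis using False by (simp add: w_def)
  qed
  from det_add_span_preceding_rows[OF b(1) this]
  have det_w: "det (\<chi> i. w i) = det (\<chi> i. x (b i))" .
  have "det (\<chi> i. x (b i)) \<in> \<int>"
    by (rule det_in_Ints) (auto simp: x_def split: option.splits)
  with nz have "1 \<le> \<bar>det (\<chi> i. x (b i))\<bar>" using Ints_nonzero_abs_ge1 by blast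
  then have "1 \<le> \<bar>real_of_rat (det (\<chi> i. w i))\<bar>"
    unfolding det_w by (metis abs_of_rat of_rat_1 of_rat_less_eq)
  moreover define W where "W = (\<chi> i j. real_of_rat (w i $ j))"
  ultimately have "1 \<le> \<bar>det W\<bar>" by (simp add: of_rat_det)
  define B where "B i = 2 * q (b i) * E (b i - 1) / q (b i - 1)" for i
  have W_None: "W $ i $ None = 0" if "i \<noteq> i0" for i
    using that q(2)[of "b i - 1"] by (simp add: W_def w_def x_def t_def)
  have W_Some: "\<bar>W $ i $ Some l\<bar> \<le> B i" if "i \<noteq> i0" for i l
  proof -
    let ?j = "b i" and ?j' = "b i - 1"
    let ?d = "\<lambda>j. of_int (int (q j)) * \<theta> $ l - of_int (a j $ l)"
    let ?t = "real (q ?j) / real (q ?j')"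
    have j: "?j = Suc ?j'" using gt[OF that] by simp
    have q': "0 < real (q ?j')" using q(2)[of ?j'] by simp
    have t1: "1 \<le> ?t"
      using q' strict_mono_leD[OF q(1), of ?j' ?j] by simp
    have "W $ i $ Some l = of_int (a ?j $ l) - ?t * of_int (a ?j' $ l)"
      using that by (simp add: W_def w_def x_def t_def of_rat_diff of_rat_mult of_rat_divide)
    \<comment> \<open>The \<theta> terms cancel because \<open>?t * q ?j' = q ?j\<close>, leaving
      only errors.\<close>
    also have "\<dots> = ?t * ?d ?j' - ?d ?j"
      using q' by (simp add: field_simps)
    finally have "\<bar>W $ i $ Some l\<bar> \<le> \<bar>?t * ?d ?j'\<bar> + \<bar>?d ?j\<bar>"
      by (simp only: abs_triangle_ineq4)
    also have "\<bar>?t * ?d ?j'\<bar> = ?t * \<bar>?d ?j'\<bar>"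
      by (simp only: abs_mult abs_divide abs_of_nat)
    also have "?t * \<bar>?d ?j'\<bar> + \<bar>?d ?j\<bar> \<le> ?t * E ?j' + E ?j"
      using t1 by (intro add_mono mult_left_mono) (auto simp only: E_def intro: approx_err_ge)
    \<comment> \<open>Decreasing errors and \<open>?t \<ge> 1\<close> absorb the second term into
      the first; this is the origin of the factor 2.\<close>
    also have "\<dots> \<le> 2 * (?t * E ?j')"
    proof -
      have "E ?j \<le> 1 * E ?j'" using E[of ?j'] j by simp
      also have "\<dots> \<le> ?t * E ?j'"
        using t1 by (rule mult_right_mono) (simp add: E_def approx_err_nonneg)
      finally show ?thesis by (simp only: mult_2 add_le_cancel_left)
    qed
    finally show ?thesis by (simp add: B_def)
  qed
  have "B i \<ge> 0" for i
    by (simp add: B_def E_def approx_err_nonneg)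
  then have W: "\<bar>W $ i $ l\<bar> \<le> B i" if "i \<noteq> i0" for i l
    using W_None[OF that] W_Some[OF that] by (cases l) auto
  have "\<bar>W $ i0 $ None\<bar> = q k" by (simp add: W_def w_def x_def)
  with abs_det_le[of i0 W None B, OF W_None W] \<open>1 \<le> \<bar>det W\<bar>\<close>
  have fin: "1 \<le> fact (Suc CARD('m)) * (q k * (\<Prod>i\<in>UNIV - {i0}. B i))"
    by (simp add: card_UNIV_option)
  have inj: "inj_on b (UNIV - {i0})" using b(1) inj_on_subset by blast
  show thesis
  proof (rule that[of "b ` (UNIV - {i0})"])
    show "card (b ` (UNIV - {i0})) = CARD('m)"
      using inj by (simp add: card_image card_Diff_singleton card_UNIV_option)
    show "1 \<le> fact (Suc CARD('m)) * (q k * (\<Prod>j\<in>b ` (UNIV - {i0}). 2 * q j * E (j - 1) / q (j - 1)))"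
      using fin by (simp add: prod.reindex[OF inj] B_def)
  qed (use gt in auto)
qed

section \<open>Growth of the denominators and the uniform exponent\<close>

text \<open>Induction on the largest index \<open>j\<close>. Gaps between selected indices cost
  nothing, since \<open>X\<close> is monotone and \<open>P r \<ge> 0\<close>. Dividing by
  \<open>X (j - 1)\<close> makes its exponent \<open>P r - 1 \<le> 0\<close>, so the growth
  hypothesis, a lower bound for \<open>X (j - 1)\<close>, converts the power into one of
  \<open>X j\<close> at the cost of one factor \<open>C\<close>.\<close>

lemma product_growth_bound:
  fixes X :: "nat \<Rightarrow> real" and g h :: real and P :: "nat \<Rightarrow> real"
  defines "P \<equiv> \<lambda>r. 1 - h * (\<Sum>i<r. g ^ i)"
  assumes X: "mono X" "\<And>j. 1 \<le> X j"
    and C: "1 \<le> C" "\<And>j. k < j \<Longrightarrow> X j powr g \<le> C * X (j - 1)"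
    and gh: "0 \<le> g" "0 \<le> h"
    and J: "finite J" "J \<subseteq> {k<..}"
    and P: "0 \<le> P (card J)"
  shows "X k * (\<Prod>j\<in>J. X j powr (1 - h) / X (j - 1)) \<le> C ^ card J * X (Max (insert k J)) powr P (card J)"
  using J P
proof (induction J rule: finite_linorder_max_induct)
  case empty
  then show ?case using X(2)[of k] by (simp add: P_def)
next
  case (insert j J)
  let ?r = "card J" and ?m = "Max (insert k J)"
  have Xpos: "0 < X i" for i using X(2)[of i] by simp
  have notin: "j \<notin> J" using insert.hyps by blast
  have r: "card (insert j J) = Suc ?r" using insert.hyps(1) notin by simp
  \<comment> \<open>\<open>P\<close> decreases, so nonnegativity at the final cardinality passes
    down to all earlier ones.\<close>
  have P_le: "P (Suc ?r) \<le> P ?r" using gh by (simp add: P_def mult_left_mono)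
  have P1: "P ?r \<le> 1" using gh by (simp add: P_def sum_nonneg)
  have P0: "0 \<le> P ?r" using P_le insert.prems(2) r by simp
  have P_Suc: "P (Suc ?r) = (1 - h) + g * (P ?r - 1)"
    unfolding P_def sum.lessThan_Suc_shift by (simp add: sum_distrib_left[symmetric] algebra_simps)
  have kj: "k < j" using insert.prems by simp
  have "?m < j" using insert.hyps kj by simp
  then have m: "?m \<le> j - 1" by simp
  have max: "Max (insert k (insert j J)) = j"
    using insert.hyps(1) insert.hyps(2) kj by (intro Max_eqI) (auto simp: less_imp_le)
  have "X k * (\<Prod>j\<in>J. X j powr (1 - h) / X (j - 1)) \<le> C ^ ?r * X ?m powr P ?r"
    using insert.IH insert.prems P0 by simp
  also have "\<dots> \<le> C ^ ?r * X (j - 1) powr P ?r"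
    using C(1) P0 monoD[OF X(1) m] Xpos[of ?m] by (intro mult_left_mono powr_mono2) auto
  finally have IH: "X k * (\<Prod>j\<in>J. X j powr (1 - h) / X (j - 1)) \<le> C ^ ?r * X (j - 1) powr P ?r" .
  have step: "X (j - 1) powr (P ?r - 1) \<le> C * X j powr (g * (P ?r - 1))"
  proof -
    have "X j powr g / C \<le> X (j - 1)" using C(1) C(2)[OF kj] by (simp add: field_simps)
    then have "X (j - 1) powr (P ?r - 1) \<le> (X j powr g / C) powr (P ?r - 1)"
      using C(1) P1 Xpos[of j] by (intro powr_mono2') auto
    also have "\<dots> = X j powr (g * (P ?r - 1)) * C powr (1 - P ?r)"
    proof -
      have "(X j powr g / C) powr u = X j powr (g * u) * C powr (- u)" for u
        using C(1) Xpos[of j] by (simp add: powr_divide powr_powr powr_minus_divide)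
      then show ?thesis by simp
    qed
    \<comment> \<open>As \<open>P ?r \<ge> 0\<close> and \<open>C \<ge> 1\<close>, the exponent of
      \<open>C\<close> can be raised to 1.\<close>
    also have "\<dots> \<le> X j powr (g * (P ?r - 1)) * C powr 1"
      using C(1) P0 by (intro mult_left_mono powr_mono) auto
    finally show ?thesis using C(1) by (simp add: mult.commute)
  qed
  have "X k * (\<Prod>i\<in>insert j J. X i powr (1 - h) / X (i - 1))
      = (X k * (\<Prod>i\<in>J. X i powr (1 - h) / X (i - 1))) * (X j powr (1 - h) / X (j - 1))"
    using insert.hyps(1) notin by simp
  also have "\<dots> \<le> (C ^ ?r * X (j - 1) powr P ?r) * (X j powr (1 - h) / X (j - 1))"
    using IH Xpos[of "j - 1"] by (intro mult_right_mono) auto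
  also have "\<dots> = C ^ ?r * X (j - 1) powr (P ?r - 1) * X j powr (1 - h)"
    using Xpos[of "j - 1"] by (simp add: powr_diff)
  also have "\<dots> \<le> C ^ ?r * (C * X j powr (g * (P ?r - 1))) * X j powr (1 - h)"
    using step C(1) by (intro mult_right_mono mult_left_mono) auto
  also have "\<dots> = C ^ Suc ?r * X j powr P (Suc ?r)"
    by (simp add: P_Suc powr_add mult_ac)
  finally show ?case by (simp add: r max)
qed


text \<open>An admissible \<gamma> > h leaves a surplus \<epsilon> = \<gamma> - h in the bound for
  each \<open>E (j - 1)\<close>. Without the surplus the determinant estimate is bounded by a
  constant; with it, a late starting index \<open>k\<close> pushes the estimate below 1.\<close>

proposition omega_hat_le_H:
  fixes \<theta> :: "real ^ 'm::finite"
  assumes s: "2 \<le> s"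
    and c: "0 < c" "\<And>q a. 0 < q \<Longrightarrow> c * of_int q powr (- (real s - 1)) \<le> approx_err \<theta> q a"
    and irr: "totally_irrational \<theta>"
  shows "omega_hat \<theta> \<le> ereal (H (CARD('m) - 1) s)"
  unfolding omega_hat_def approx_err_def[symmetric]
proof (rule Sup_least)
  define h where "h = H (CARD('m) - 1) s"
  define g where "g = h / (real s - 1)"
  define N where "N = CARD('m)"
  have N: "1 \<le> N" by (simp add: N_def Suc_le_eq)
  have s1: "0 < real s - 1" using s by simp
  have h: "0 < h" "1 - h = h * (\<Sum>k=1..N - 1. g ^ k)"
    using theI'[OF H_ex1[OF s, of "N - 1"]] by (auto simp: h_def g_def H_def N_def)
  have g: "0 \<le> g" using h(1) s1 by (simp add: g_def)
  \<comment> \<open>The equation defining \<open>H\<close> says exactly that the exponent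
    \<open>P N\<close> in \<open>product_growth_bound\<close> vanishes.\<close>
  have root: "1 - h * (\<Sum>i<N. g ^ i) = 0"
  proof -
    have "{..<N} = insert 0 {1..N - 1}" using N by auto
    then have "(\<Sum>i<N. g ^ i) = 1 + (\<Sum>k=1..N - 1. g ^ k)" by simp
    then show ?thesis using h(2) by (simp add: algebra_simps)
  qed
  fix z assume "z \<in> {ereal \<gamma> | \<gamma>. \<forall>\<^sub>F Q :: real in at_top. \<exists>(q :: int) (a :: int ^ 'm). 1 \<le> q \<and> of_int q \<le> Q \<and>
       approx_err \<theta> q a < Q powr (- \<gamma>)}"
  then obtain \<gamma> where z: "z = ereal \<gamma>" and ev: "\<forall>\<^sub>F Q :: real in at_top. \<exists>(q :: int) (a :: int ^ 'm).
      1 \<le> q \<and> of_int q \<le> Q \<and> approx_err \<theta> q a < Q powr (- \<gamma>)"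
    by auto
  have "\<gamma> \<le> h"
  proof (rule ccontr)
    assume "\<not> \<gamma> \<le> h"
    define \<epsilon> where "\<epsilon> = \<gamma> - h"
    with \<open>\<not> \<gamma> \<le> h\<close> have \<epsilon>: "0 < \<epsilon>" by simp
    have \<gamma>: "0 < \<gamma>" using h(1) \<open>\<not> \<gamma> \<le> h\<close> by simp
    have pos: "0 < approx_err \<theta> q a" if "0 < q" for q a
    proof -
      have "0 < c * of_int q powr (- (real s - 1))" using c(1) that by simp
      with c(2)[OF that, of a] show ?thesis by linarith
    qed
    obtain q a k0 where q: "strict_mono q" "\<And>j. 1 \<le> q j"
      and dec: "\<And>j. approx_err \<theta> (int (q (Suc j))) (a (Suc j)) \<le> approx_err \<theta> (int (q j)) (a j)"
      and small: "\<And>j. k0 \<le> j \<Longrightarrow> approx_err \<theta> (int (q j)) (a j) \<le> q (Suc j) powr (- \<gamma>)"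
      using best_approximations[OF pos \<gamma> ev] by metis
    define E where "E j = approx_err \<theta> (int (q j)) (a j)" for j
    define X where "X j = real (q j)" for j
    have X1: "1 \<le> X j" for j using q(2)[of j] by (simp add: X_def)
    have Xpos: "0 < X j" for j using X1[of j] by linarith
    have monoX: "mono X"
      using q(1) by (auto simp: X_def mono_def strict_mono_less_eq)
    \<comment> \<open>Obtained by comparing \<open>c * X j powr (- (real s - 1))\<close> with
      \<open>X (Suc j) powr (- h)\<close> and taking a root; the maximum with 1 secures
      \<open>C \<ge> 1\<close>.\<close>
    define C where "C = max 1 ((1 / c) powr (1 / (real s - 1)))"
    have C1: "1 \<le> C" by (simp add: C_def)
    have growth: "X (Suc j) powr g \<le> C * X j" if "k0 \<le> j" for j
    proof -
      have "c * X j powr (- (real s - 1)) \<le> E j"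
        using c(2)[of "int (q j)" "a j"] q(2)[of j] by (simp add: X_def E_def)
      also have "\<dots> \<le> X (Suc j) powr (- \<gamma>)" using small[OF that] by (simp add: X_def E_def)
      also have "\<dots> \<le> X (Suc j) powr (- h)"
        using X1[of "Suc j"] \<epsilon> by (intro powr_mono) (auto simp: \<epsilon>_def)
      finally have "X (Suc j) powr h \<le> (1 / c) * X j powr (real s - 1)"
        using c(1) Xpos[of j] Xpos[of "Suc j"] unfolding powr_minus_divide by (simp add: field_simps)
      then have "(X (Suc j) powr h) powr (1 / (real s - 1))
          \<le> ((1 / c) * X j powr (real s - 1)) powr (1 / (real s - 1))"
        using s1 by (intro powr_mono2) auto
      also have "(X (Suc j) powr h) powr (1 / (real s - 1)) = X (Suc j) powr g"
        by (simp add: powr_powr g_def)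
      also have "((1 / c) * X j powr (real s - 1)) powr (1 / (real s - 1))
          = (1 / c) powr (1 / (real s - 1)) * X j"
        using c(1) s1 Xpos[of j] by (subst powr_mult) (auto simp: powr_powr)
      also have "\<dots> \<le> C * X j"
        using Xpos[of j] by (intro mult_right_mono) (auto simp: C_def)
      finally show ?thesis .
    qed
    \<comment> \<open>Chosen so that
      \<open>2 * \<delta> * C = 1 / (2 * fact (Suc N))\<close>.\<close>
    define \<delta> where "\<delta> = 1 / (4 * C * fact (Suc N))"
    have \<delta>: "0 < \<delta>" using C1 by (simp add: \<delta>_def)
    obtain k where k: "k0 \<le> k" "X k powr (- \<epsilon>) \<le> \<delta>"
    proof -
      have "filterlim X at_top sequentially"
        unfolding X_def using filterlim_compose[OF filterlim_real_sequentially filterlim_subseq[OF q(1)]] .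
      then have "((\<lambda>j. X j powr (- \<epsilon>)) \<longlongrightarrow> 0) sequentially"
        using \<epsilon> by (intro tendsto_neg_powr) auto
      then have "\<forall>\<^sub>F j in sequentially. X j powr (- \<epsilon>) < \<delta>"
        using \<delta> by (rule order_tendstoD(2))
      then have "\<forall>\<^sub>F j in sequentially. X j powr (- \<epsilon>) < \<delta> \<and> k0 \<le> j"
        by (rule eventually_conj[OF _ eventually_ge_at_top])
      from eventually_happens'[OF sequentially_bot this] obtain j where "X j powr (- \<epsilon>) < \<delta>" "k0 \<le> j" by blast
      then show thesis by (intro that[of j]) auto
    qed
    obtain J where J: "finite J" "J \<subseteq> {k<..}" "card J = N"
      and det: "1 \<le> fact (Suc N) * (X k * (\<Prod>j\<in>J. 2 * X j * E (j - 1) / X (j - 1)))"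
    proof -
      obtain J where "finite J" "J \<subseteq> {k<..}" "card J = CARD('m)"
        "1 \<le> fact (Suc CARD('m)) * (q k * (\<Prod>j\<in>J. 2 * q j * approx_err \<theta> (q (j - 1)) (a (j - 1)) / q (j - 1)))"
        using approximation_determinant_bound[OF irr q dec] by blast
      then show thesis by (intro that[of J]) (simp_all add: N_def X_def E_def)
    qed
    \<comment> \<open>Splitting \<gamma> = h + \<epsilon> turns the surplus power into at most
      \<delta>, because j > k.\<close>
    have factor: "2 * X j * E (j - 1) / X (j - 1) \<le> (2 * \<delta>) * (X j powr (1 - h) / X (j - 1))"
      if "j \<in> J" for j
    proof -
      have j: "k < j" using that J(2) by auto
      then have "E (j - 1) \<le> X j powr (- \<gamma>)"
        using small[of "j - 1"] k(1) by (simp add: X_def E_def)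
      also have "\<dots> = X j powr (- \<epsilon>) * X j powr (- h)"
        by (simp add: powr_add[symmetric] \<epsilon>_def)
      also have "\<dots> \<le> \<delta> * X j powr (- h)"
      proof (rule mult_right_mono)
        have "X j powr (- \<epsilon>) \<le> X k powr (- \<epsilon>)"
          using \<epsilon> Xpos[of k] monoD[OF monoX, of k j] j by (intro powr_mono2') auto
        with k(2) show "X j powr (- \<epsilon>) \<le> \<delta>" by simp
      qed simp
      finally have "(2 * X j / X (j - 1)) * E (j - 1) \<le> (2 * X j / X (j - 1)) * (\<delta> * X j powr (- h))"
        using Xpos[of j] Xpos[of "j - 1"] by (intro mult_left_mono) auto
      also have "\<dots> = (2 * \<delta>) * (X j powr (1 - h) / X (j - 1))"
        using Xpos[of j] by (simp add: powr_diff powr_minus_divide field_simps)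
      finally show ?thesis by simp
    qed
    have prod: "X k * (\<Prod>j\<in>J. X j powr (1 - h) / X (j - 1)) \<le> C ^ N"
    proof -
      have "X j powr g \<le> C * X (j - 1)" if "k < j" for j
        using growth[of "j - 1"] that k(1) by simp
      from product_growth_bound[OF monoX X1 C1 this g less_imp_le[OF h(1)] J(1,2)]
      show ?thesis using root Xpos[of "Max (insert k J)"] by (simp add: J(3))
    qed
    have "X k * (\<Prod>j\<in>J. 2 * X j * E (j - 1) / X (j - 1))
        \<le> X k * (\<Prod>j\<in>J. (2 * \<delta>) * (X j powr (1 - h) / X (j - 1)))"
    proof (intro mult_left_mono prod_mono conjI)
      show "0 \<le> 2 * X j * E (j - 1) / X (j - 1)" for j
        using Xpos[of j] Xpos[of "j - 1"] by (simp add: E_def approx_err_nonneg)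
    qed (use factor Xpos[of k] in auto)
    also have "\<dots> = (2 * \<delta>) ^ N * (X k * (\<Prod>j\<in>J. X j powr (1 - h) / X (j - 1)))"
      by (simp add: prod.distrib[of "\<lambda>_. 2 * \<delta>"] J(3) power_mult_distrib del: times_divide_eq_right)
    also have "\<dots> \<le> (2 * \<delta>) ^ N * C ^ N"
      using prod \<delta> by (intro mult_left_mono) auto
    also have "\<dots> = (1 / (2 * fact (Suc N))) ^ N"
      using C1 by (simp add: \<delta>_def power_mult_distrib[symmetric] mult.commute)
    \<comment> \<open>The base is at most 1 and N \<ge> 1, so one factor suffices: it cancels the
      factorial and leaves 1/2, against the lower bound 1.\<close>
    also have "\<dots> \<le> (1 / (2 * fact (Suc N))) ^ 1"
    proof (rule power_decreasing[OF N])
      have "1 \<le> (fact (Suc N) :: real)" by (rule fact_ge_1)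
      then have "1 \<le> 2 * (fact (Suc N) :: real)" by linarith
      then show "1 / (2 * fact (Suc N)) \<le> (1 :: real)" by (simp del: fact_Suc)
    qed (simp del: fact_Suc)
    finally have "fact (Suc N) * (X k * (\<Prod>j\<in>J. 2 * X j * E (j - 1) / X (j - 1)))
        \<le> fact (Suc N) * (1 / (2 * fact (Suc N)))"
      unfolding power_one_right by (rule mult_left_mono) (rule fact_ge_zero)
    also have "\<dots> = 1 / 2" by (simp del: fact_Suc)
    finally show False using det by linarith
  qed
  then show "z \<le> ereal (H (CARD('m) - 1) s)" by (simp add: z h_def)
qed

theorem mainTheorem6:
  fixes s :: nat
    and f :: "('n::finite, rat) mpoly"
    and \<xi> :: "real ^ 'n"
  assumes "2 \<le> s"
    and "total_degree f = s"
    and "finite {x :: rat ^ 'n. mpoly_eval f x = 1}"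
    and "\<not> (\<forall>i. \<xi> $ i \<in> \<rat>)"
    and "mpoly_eval f \<xi> = 1"
  shows "omega \<xi> \<le> ereal (real s - 1)
    \<and> (totally_irrational \<xi> \<longrightarrow> omega_hat \<xi> \<le> ereal (H (CARD('n) - 1) s))"
proof -
  have "1 \<le> total_degree f" using assms(1,2) by simp
  then obtain c where c: "0 < c"
    "\<And>q a. 0 < q \<Longrightarrow> c * of_int q powr (- (real s - 1)) \<le> approx_err \<xi> q a"
    using liouville_bound[OF _ assms(3-5)] assms(2) by metis
  have "omega \<xi> \<le> ereal (real s - 1)"
    using omega_le_if_approx_err_ge[OF c] assms(1) by simp
  with omega_hat_le_H[OF assms(1) c] show ?thesis by blast
qed

end
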